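(* Let $D$ be an oriented diagram of a knot. Form a graph (multigraph) $G$ which has a node for each component of $T^-(D)$ and a node for each component of $T^+(D)$. Each circle in $O(D)$ is a member of exactly one component of $T^-(D)$ and exactly one component of $T^+(D)$; for each circle in $O(D)$ let $G$ have an edge connecting the corresponding pair of nodes. Then $$\Delta(D)=b_1(G),$$ the first Betti number of $G$.
   Context: Let $O(D)$ be the oriented resolution of $D$ (every crossing is smoothed respecting orientation), a disjoint union of circles. The Seifert graph $T(D)$ has one node for each circle of $O(D)$ and, for each positive (respectively negative) crossing of $D$, one edge decorated with $+$ (respectively $-$) joining the two distinct circles on which the smoothed crossing lies. The subgraph $T^-(D)$ (respectively $T^+(D)$) is obtained from $T(D)$ by removing all edges decorated with $+$ (respectively $-$), keeping all nodes. A circle of $O(D)$ is identified with the corresponding node of $T(D)$, $T^-(D)$ and $T^+(D)$. Define $$\Delta(D)=\#\mathrm{nodes}(T(D))-\#\mathrm{components}(T^-(D))-\#\mathrm{components}(T^+(D))+1 .$$ *)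

theory Defs
  imports
    "Graph_Theory.Digraph_Component"
    "HOL-Library.Function_Algebras"
    "HOL-Analysis.Analysis"
begin

section \<open>Multigraphs\<close>

text \<open>
  An undirected multigraph is represented by a \<^type>\<open>pre_digraph\<close>: every edge carries an
  arbitrary orientation, which affects neither the connected components nor the Betti number.
\<close>

text \<open>The vertex sets of the connected components of the underlying undirected multigraph.\<close>

definition conn_components :: "('v, 'e) pre_digraph \<Rightarrow> 'v set set" where
  "conn_components G = pre_digraph.sccs_verts (with_proj (mk_symmetric G))"

definition component_of :: "('v, 'e) pre_digraph \<Rightarrow> 'v \<Rightarrow> 'v set" where
  "component_of G v = (THE K. K \<in> conn_components G \<and> v \<in> K)"

text \<open>
  Cellular homology of a finite graph with rational coefficients: 1-chains are the functions
  supported on the edges, and since there are no 2-cells, \<open>H\<^sub>1\<close> is the kernel of the boundary map.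
\<close>

definition chain_boundary :: "('v, 'e) pre_digraph \<Rightarrow> ('e \<Rightarrow> rat) \<Rightarrow> 'v \<Rightarrow> rat" where
  "chain_boundary G f v = (\<Sum>e\<in>in_arcs G v. f e) - (\<Sum>e\<in>out_arcs G v. f e)"

definition cycle_space :: "('v, 'e) pre_digraph \<Rightarrow> ('e \<Rightarrow> rat) set" where
  "cycle_space G =
     {f. (\<forall>e. e \<notin> arcs G \<longrightarrow> f e = 0) \<and> (\<forall>v\<in>verts G. chain_boundary G f v = 0)}"

definition betti1 :: "('v, 'e) pre_digraph \<Rightarrow> nat" where
  "betti1 G = vector_space.dim (\<lambda>(c::rat) f e. c * f e) (cycle_space G)"


section \<open>Oriented knot diagrams\<close>

text \<open>
  The plane is \<^typ>\<open>complex\<close>. The knot projection is a closed curve, given as a 1-periodic function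
  on the real line and oriented by increasing parameter. At a parameter \<open>s\<close> that runs through a
  crossing, \<open>over D s\<close> says whether the strand through \<open>s\<close> is the overpassing one;
  elsewhere \<open>over D\<close> is irrelevant.
\<close>

record knot_diagram =
  curve :: "real \<Rightarrow> complex"
  over :: "real \<Rightarrow> bool"

text \<open>Every crossing occurs twice here, as \<open>(s, t)\<close> and as \<open>(t, s)\<close>.\<close>

definition double_params :: "knot_diagram \<Rightarrow> (real \<times> real) set" where
  "double_params D =
     {(s, t). s \<in> {0..<1} \<and> t \<in> {0..<1} \<and> s \<noteq> t \<and> curve D s = curve D t}"

abbreviation velocity :: "knot_diagram \<Rightarrow> real \<Rightarrow> complex" where
  "velocity D s \<equiv> vector_derivative (curve D) (at s)"

text \<open>\<open>Im (cnj a * b)\<close> is the determinant of the pair of plane vectors \<open>(a, b)\<close>.\<close>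

abbreviation plane_det :: "complex \<Rightarrow> complex \<Rightarrow> real" where
  "plane_det a b \<equiv> Im (cnj a * b)"

text \<open>
  A regular closed curve whose only singularities are finitely many transverse double points,
  with exactly one of the two strands at each double point marked as passing over.
\<close>

definition oriented_knot_diagram :: "knot_diagram \<Rightarrow> bool" where
  "oriented_knot_diagram D \<longleftrightarrow>
     (\<forall>t. curve D (t + 1) = curve D t) \<and>
     curve D C1_differentiable_on UNIV \<and>
     (\<forall>t. velocity D t \<noteq> 0) \<and>
     finite (double_params D) \<and>
     (\<forall>s t u. (s, t) \<in> double_params D \<and> (s, u) \<in> double_params D \<longrightarrow> t = u) \<and>
     (\<forall>(s, t)\<in>double_params D. plane_det (velocity D s) (velocity D t) \<noteq> 0) \<and>
     (\<forall>(s, t)\<in>double_params D. over D s \<noteq> over D t)"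

text \<open>A crossing is the pair of its overpassing and its underpassing parameter.\<close>

definition crossings :: "knot_diagram \<Rightarrow> (real \<times> real) set" where
  "crossings D = {(s, t) \<in> double_params D. over D s \<and> \<not> over D t}"

text \<open>
  A crossing is positive if the overpassing direction followed by the underpassing direction
  is a positively oriented basis of the plane (the right-handed crossing).
\<close>

definition positive_crossing :: "knot_diagram \<Rightarrow> real \<times> real \<Rightarrow> bool" where
  "positive_crossing D = (\<lambda>(s, t). plane_det (velocity D s) (velocity D t) > 0)"

definition negative_crossing :: "knot_diagram \<Rightarrow> real \<times> real \<Rightarrow> bool" where
  "negative_crossing D = (\<lambda>(s, t). plane_det (velocity D s) (velocity D t) < 0)"


section \<open>Oriented resolution and Seifert graph\<close>

text \<open>
  The open segments into which the crossing points cut the projection. Without crossings the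
  whole curve is the only segment.
\<close>

definition segments :: "knot_diagram \<Rightarrow> complex set set" where
  "segments D = components (range (curve D) - (curve D \<circ> fst) ` double_params D)"

definition incoming :: "knot_diagram \<Rightarrow> real \<Rightarrow> complex set" where
  "incoming D s = (THE A. A \<in> segments D \<and> (\<forall>\<^sub>F u in at_left s. curve D u \<in> A))"

definition outgoing :: "knot_diagram \<Rightarrow> real \<Rightarrow> complex set" where
  "outgoing D s = (THE A. A \<in> segments D \<and> (\<forall>\<^sub>F u in at_right s. curve D u \<in> A))"

text \<open>
  Smoothing a crossing with respect to the orientation joins the segment coming in along each of
  its two strands to the segment going out along the other strand. In the resulting graph on the
  segments every segment has exactly one predecessor and one successor (unless there are no
  crossings), so the components are the closed oriented circles of the resolution; a circle is
  represented by the set of the segments it consists of.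
\<close>

definition oriented_resolution :: "knot_diagram \<Rightarrow> (complex set, real \<times> real) pre_digraph" where
  "oriented_resolution D =
     \<lparr> verts = segments D, arcs = double_params D,
       tail = (\<lambda>(s, t). incoming D s), head = (\<lambda>(s, t). outgoing D t) \<rparr>"

definition circles :: "knot_diagram \<Rightarrow> complex set set set" where
  "circles D = conn_components (oriented_resolution D)"

text \<open>
  The two circles on which a smoothed crossing lies are those containing its two incoming
  segments.
\<close>

definition seifert_graph :: "knot_diagram \<Rightarrow> (complex set set, real \<times> real) pre_digraph" where
  "seifert_graph D =
     \<lparr> verts = circles D, arcs = crossings D,
       tail = (\<lambda>(s, t). component_of (oriented_resolution D) (incoming D s)),
       head = (\<lambda>(s, t). component_of (oriented_resolution D) (incoming D t)) \<rparr>"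

definition seifert_minus :: "knot_diagram \<Rightarrow> (complex set set, real \<times> real) pre_digraph" where
  "seifert_minus D = (seifert_graph D)
     \<lparr> arcs := arcs (seifert_graph D) - Collect (positive_crossing D) \<rparr>"

definition seifert_plus :: "knot_diagram \<Rightarrow> (complex set set, real \<times> real) pre_digraph" where
  "seifert_plus D = (seifert_graph D)
     \<lparr> arcs := arcs (seifert_graph D) - Collect (negative_crossing D) \<rparr>"

definition Delta :: "knot_diagram \<Rightarrow> int" where
  "Delta D = int (card (verts (seifert_graph D)))
     - int (card (conn_components (seifert_minus D)))
     - int (card (conn_components (seifert_plus D))) + 1"

text \<open>
  The nodes form a disjoint union: a component of \<open>T\<^sup>-\<close> and a component of \<open>T\<^sup>+\<close> are different
  nodes even if they consist of the same circles.
\<close>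

definition circle_graph ::
    "knot_diagram \<Rightarrow> (complex set set set + complex set set set, complex set set) pre_digraph" where
  "circle_graph D =
     \<lparr> verts = Inl ` conn_components (seifert_minus D) \<union> Inr ` conn_components (seifert_plus D),
       arcs = circles D,
       tail = (\<lambda>C. Inl (component_of (seifert_minus D) C)),
       head = (\<lambda>C. Inr (component_of (seifert_plus D) C)) \<rparr>"

end

theory Submission
  imports Defs
begin

text \<open>
  By the Euler characteristic, \<open>b\<^sub>1(G)\<close> is the number of edges minus the number of nodes plus the
  number of components of \<open>G\<close>, so the claim says exactly that \<open>G\<close> is connected. Two circles meeting
  at a crossing lie in a common component of \<open>T\<^sup>-\<close> or of \<open>T\<^sup>+\<close>, hence are adjacent as edges of \<open>G\<close>.
  So it is enough that the circles are connected through the crossings. This is seen by travelling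
  along the knot: on passing a crossing \<open>(s, t)\<close> along the strand \<open>s\<close>, the segment leaving at \<open>s\<close>
  is on the same circle of the resolution as the segment arriving at \<open>t\<close>, and that circle and the
  one of the segment arriving at \<open>s\<close> are joined by the edge of the Seifert graph at this crossing.
\<close>

section \<open>Components of multigraphs\<close>

text \<open>Connectivity as a set of pairs, so that components become classes of a quotient and the
  theory of equivalence relations applies to them.\<close>

definition linked :: "('v, 'e) pre_digraph \<Rightarrow> ('v \<times> 'v) set" where
  "linked G = {(u, v). reachable (with_proj (mk_symmetric G)) u v}"

lemma equiv_linked:
  assumes "wf_digraph G"
  shows "equiv (verts G) (linked G)"
proof -
  interpret S: pair_wf_digraph "mk_symmetric G"
    using assms by (rule wf_digraph.wellformed_mk_symmetric)
  show ?thesis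
  proof (rule equivI)
    show "linked G \<subseteq> verts G \<times> verts G"
      by (auto simp: linked_def elim: reachable_in_vertsE)
    show "refl_on (verts G) (linked G)"
      by (auto simp: linked_def refl_on_def)
    show "sym (linked G)"
      using symmetric_reachable[OF symmetric_mk_symmetric] by (auto simp: linked_def sym_def)
    show "trans (linked G)"
      by (auto simp: linked_def trans_def intro: S.reachable_trans)
  qed
qed

lemma linked_arc:
  assumes "wf_digraph G" "e \<in> arcs G"
  shows "(tail G e, head G e) \<in> linked G"
proof -
  interpret S: pair_wf_digraph "mk_symmetric G"
    using assms(1) by (rule wf_digraph.wellformed_mk_symmetric)
  show ?thesis
    unfolding linked_def mem_Collect_eq prod.case
    by (rule S.reachable_adjI) (use assms in \<open>auto simp: parcs_mk_symmetric\<close>)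
qed

text \<open>Reachability is generated by single steps, each of them an arc or its reverse. This
  replaces induction along paths: every upper bound on connectivity below is obtained by exhibiting
  a suitable equivalence relation \<open>R\<close>.\<close>

lemma linked_least:
  assumes R: "equiv (verts G) R"
    and arc: "\<And>e. e \<in> arcs G \<Longrightarrow> (tail G e, head G e) \<in> R"
  shows "linked G \<subseteq> R"
proof -
  have "(u, v) \<in> R"
    if "(u, v) \<in> rtrancl_on (verts G) (arcs_ends (with_proj (mk_symmetric G)))" for u v
    using that
  proof (induction rule: rtrancl_on_induct)
    case base
    then show ?case using R by (auto simp: equiv_def refl_on_def)
  next
    case (step y z)
    have "(y, z) \<in> R"
      using step(2) arc R by (auto simp: parcs_mk_symmetric equiv_def dest: symD)
    with step R show ?case by (auto simp: equiv_def dest: transD)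
  qed
  then show ?thesis by (auto simp: linked_def reachable_def)
qed

text \<open>Strong components are the maximal sets of mutually reachable nodes. In the symmetrized
  graph reachability is itself symmetric, so these sets are exactly its classes.\<close>

lemma conn_components_eq_quotient:
  assumes "wf_digraph G"
  shows "conn_components G = verts G // linked G"
proof -
  note eq = equiv_linked[OF assms]
  have conv: "reachable (with_proj (mk_symmetric G)) u v \<longleftrightarrow> (u, v) \<in> linked G" for u v
    by (simp add: linked_def)
  have sym: "(u, v) \<in> linked G \<longleftrightarrow> (v, u) \<in> linked G" for u v
    using eq by (auto simp: equiv_def dest: symD)
  show ?thesis
  proof (intro set_eqI iffI)
    fix S assume "S \<in> conn_components G"
    then have S: "S \<noteq> {}" "\<And>u v. u \<in> S \<Longrightarrow> v \<in> S \<Longrightarrow> (u, v) \<in> linked G"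
      "\<And>u v. u \<in> S \<Longrightarrow> v \<notin> S \<Longrightarrow> (u, v) \<notin> linked G"
      by (auto simp: conn_components_def pre_digraph.sccs_verts_def conv sym)
    then obtain u where u: "u \<in> S" by blast
    have "S = linked G `` {u}" using S u by blast
    moreover have "u \<in> verts G" using S(2)[OF u u] eq by (auto simp: equiv_def)
    ultimately show "S \<in> verts G // linked G" by (auto intro: quotientI)
  next
    fix S assume S: "S \<in> verts G // linked G"
    have "(u, v) \<notin> linked G" if "u \<in> S" "v \<notin> S" for u v
      using eq S that by (metis in_quotient_imp_closed)
    then show "S \<in> conn_components G"
      using in_quotient_imp_non_empty[OF eq S] quotient_eq_iff[OF eq S S]
      by (auto simp: conn_components_def pre_digraph.sccs_verts_def conv)
  qed
qed

text \<open>Classes of an equivalence cover the nodes and are disjoint. This justifies the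
  description operator in \<open>component_of\<close>, and it also yields the claim that a circle
  has exactly one component in each of the two signed subgraphs.\<close>

lemma ex1_conn_component:
  assumes "wf_digraph G" "v \<in> verts G"
  shows "\<exists>!K. K \<in> conn_components G \<and> v \<in> K"
proof -
  note eq = equiv_linked[OF assms(1)]
  obtain K where K: "K \<in> verts G // linked G" "v \<in> K"
    using Union_quotient[OF eq] assms(2) by blast
  moreover have "L = K" if "L \<in> verts G // linked G" "v \<in> L" for L
    using quotient_disj[OF eq that(1) K(1)] that(2) K(2) by blast
  ultimately show ?thesis
    unfolding conn_components_eq_quotient[OF assms(1)] by blast
qed

lemma component_of_eq:
  assumes "wf_digraph G" "v \<in> verts G"
  shows "component_of G v = linked G `` {v}"
  unfolding component_of_def
proof (rule the1_equality[OF ex1_conn_component[OF assms]])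
  show "linked G `` {v} \<in> conn_components G \<and> v \<in> linked G `` {v}"
    using assms equiv_linked[OF assms(1)]
    unfolding conn_components_eq_quotient[OF assms(1)]
    using equiv_class_self[OF equiv_linked[OF assms(1)] assms(2)] quotientI[OF assms(2)] by blast
qed

lemma component_of_in_conn_components:
  assumes "wf_digraph G" "v \<in> verts G"
  shows "component_of G v \<in> conn_components G"
  using assms by (simp add: component_of_eq conn_components_eq_quotient quotientI)

lemma conn_component_obtain:
  assumes "wf_digraph G" "K \<in> conn_components G"
  obtains v where "v \<in> verts G" "K = component_of G v"
  using assms by (metis component_of_eq conn_components_eq_quotient quotientE)

lemma component_of_eq_iff:
  assumes "wf_digraph G" "u \<in> verts G" "v \<in> verts G"
  shows "component_of G u = component_of G v \<longleftrightarrow> (u, v) \<in> linked G"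
  using assms eq_equiv_class_iff[OF equiv_linked[OF assms(1)]] by (simp add: component_of_eq)

lemma finite_conn_components:
  assumes "wf_digraph G" "finite (verts G)"
  shows "finite (conn_components G)"
  using assms equiv_linked[OF assms(1)]
  by (auto simp: conn_components_eq_quotient equiv_def intro: finite_quotient)

section \<open>Merging two classes of an equivalence relation\<close>

lemma equiv_merge:
  assumes R: "equiv A R" and uv: "u \<in> A" "v \<in> A"
  shows "equiv A (R \<union> R `` {u} \<times> R `` {v} \<union> R `` {v} \<times> R `` {u})"
proof (cases "(u, v) \<in> R")
  case True
  have "R `` {u} = R `` {v}" using R True by (rule equiv_class_eq)
  moreover have "R `` {v} \<times> R `` {v} \<subseteq> R"
    using R by (auto simp: equiv_def dest: symD transD)
  ultimately have "R \<union> R `` {u} \<times> R `` {v} \<union> R `` {v} \<times> R `` {u} = R" by auto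
  with R show ?thesis by simp
next
  case False
  have sub: "R \<subseteq> A \<times> A" and symR: "\<And>x y. (x, y) \<in> R \<Longrightarrow> (y, x) \<in> R"
    and transR: "\<And>x y z. (x, y) \<in> R \<Longrightarrow> (y, z) \<in> R \<Longrightarrow> (x, z) \<in> R"
    using R by (auto simp: equiv_def dest: symD transD)
  \<comment> \<open>The two classes are disjoint. This rules out the chains from \<open>x\<close>
    over \<open>y\<close> to \<open>z\<close> whose middle point would have to lie in both.\<close>
  have no: "False" if "(u, x) \<in> R" "(v, x) \<in> R" for x
    using False symR transR that by blast
  let ?S = "R \<union> R `` {u} \<times> R `` {v} \<union> R `` {v} \<times> R `` {u}"
  show ?thesis
  proof (rule equivI)
    show "?S \<subseteq> A \<times> A" using sub by blast
    show "refl_on A ?S" using R by (auto simp: equiv_def refl_on_def)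
    show "sym ?S" using symR by (auto simp: sym_def)
    have closed: "(a, x) \<in> R \<Longrightarrow> (x, y) \<in> R \<Longrightarrow> (a, y) \<in> R"
      "(a, y) \<in> R \<Longrightarrow> (x, y) \<in> R \<Longrightarrow> (a, x) \<in> R"
      "(a, x) \<in> R \<Longrightarrow> (a, y) \<in> R \<Longrightarrow> (x, y) \<in> R" for a x y
      using symR transR by blast+
    show "trans ?S"
    proof (rule transI)
      fix x y z assume xy: "(x, y) \<in> ?S" and yz: "(y, z) \<in> ?S"
      consider "(x, y) \<in> R" | "(u, x) \<in> R" "(v, y) \<in> R" | "(v, x) \<in> R" "(u, y) \<in> R"
        using xy by auto
      then show "(x, z) \<in> ?S"
      proof cases
        case 1
        with yz closed(1)[of x y z] closed(2)[of u y x] closed(2)[of v y x] show ?thesis by auto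
      next
        case 2
        with yz no[of y] closed(1)[of v y z] closed(3)[of u x z] show ?thesis by auto
      next
        case 3
        with yz no[of y] closed(1)[of u y z] closed(3)[of v x z] show ?thesis by auto
      qed
    qed
  qed
qed

lemma card_insert_Diff_doubleton:
  assumes "finite A" "a \<in> A" "b \<in> A" "a \<noteq> b" "c \<notin> A"
  shows "Suc (card (insert c (A - {a, b}))) = card A"
proof -
  have "card {a, b} \<le> card A"
    by (rule card_mono) (use assms in auto)
  then show ?thesis
    using assms by (simp add: card_Diff_subset)
qed

text \<open>Two distinct classes are replaced by their union and all others stay. Applied to
  \<open>linked\<close>, this is the effect on the components of a new edge between two of
  them.\<close>

lemma card_quotient_merge:
  assumes A: "finite A" and R: "equiv A R"
    and uv: "u \<in> A" "v \<in> A" "(u, v) \<notin> R"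
    and S_eq: "S = R \<union> R `` {u} \<times> R `` {v} \<union> R `` {v} \<times> R `` {u}"
  shows "Suc (card (A // S)) = card (A // R)"
proof -
  have cls: "R `` {x} = R `` {y} \<longleftrightarrow> (x, y) \<in> R" if "x \<in> A" "y \<in> A" for x y
    using R that by (rule eq_equiv_class_iff)
  have symR: "(x, y) \<in> R \<Longrightarrow> (y, x) \<in> R" for x y
    using R by (auto simp: equiv_def dest: symD)
  have transR: "(x, y) \<in> R \<Longrightarrow> (y, z) \<in> R \<Longrightarrow> (x, z) \<in> R" for x y z
    using R by (auto simp: equiv_def dest: transD)
  have reflR: "x \<in> A \<Longrightarrow> (x, x) \<in> R" for x
    using R by (auto simp: equiv_def dest: refl_onD)
  let ?U = "R `` {u}" and ?W = "R `` {v}"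
  \<comment> \<open>A point of either old class now has the union as its class; the class of any
    other point is unchanged.\<close>
  have im: "S `` {x} = (if (u, x) \<in> R \<or> (v, x) \<in> R then ?U \<union> ?W else R `` {x})"
    if "x \<in> A" for x
  proof -
    have "S `` {x} = R `` {x} \<union> (if (u, x) \<in> R then ?W else {}) \<union> (if (v, x) \<in> R then ?U else {})"
      by (auto simp: S_eq)
    moreover have "R `` {x} = ?U" if "(u, x) \<in> R"
      using equiv_class_eq[OF R that] by simp
    moreover have "R `` {x} = ?W" if "(v, x) \<in> R"
      using equiv_class_eq[OF R that] by simp
    moreover have "\<not> ((u, x) \<in> R \<and> (v, x) \<in> R)"
      using uv symR transR by blast
    ultimately show ?thesis by (auto split: if_splits)
  qed
  have AS: "A // S = insert (?U \<union> ?W) (A // R - {?U, ?W})"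
  proof (intro set_eqI iffI)
    fix X assume "X \<in> A // S"
    then obtain x where x: "x \<in> A" "X = S `` {x}" by (auto elim: quotientE)
    then show "X \<in> insert (?U \<union> ?W) (A // R - {?U, ?W})"
      using im[OF x(1)] cls[OF uv(1) x(1)] cls[OF uv(2) x(1)] by (auto intro: quotientI)
  next
    fix X assume "X \<in> insert (?U \<union> ?W) (A // R - {?U, ?W})"
    then consider "X = ?U \<union> ?W" | x where "x \<in> A" "X = R `` {x}" "X \<noteq> ?U" "X \<noteq> ?W"
      by (blast elim: quotientE)
    then show "X \<in> A // S"
    proof cases
      case 1
      then have "X = S `` {u}" using im[OF uv(1)] reflR[OF uv(1)] by simp
      then show ?thesis using quotientI[OF uv(1), of S] by (simp only:)
    next
      case 2
      then have "(u, x) \<notin> R" "(v, x) \<notin> R"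
        using cls[OF uv(1) \<open>x \<in> A\<close>] cls[OF uv(2) \<open>x \<in> A\<close>] by simp_all
      then have "X = S `` {x}" using im[of x] 2 by simp
      then show ?thesis using quotientI[OF \<open>x \<in> A\<close>, of S] by (simp only:)
    qed
  qed
  \<comment> \<open>An old class containing both \<open>u\<close> and \<open>v\<close> would relate
    them, so the union counts as a new element.\<close>
  have notin: "?U \<union> ?W \<notin> A // R"
  proof
    assume "?U \<union> ?W \<in> A // R"
    then obtain x where x: "?U \<union> ?W = R `` {x}" by (rule quotientE)
    have "u \<in> ?U" "v \<in> ?W" using reflR uv by simp_all
    with x have "(x, u) \<in> R" "(x, v) \<in> R" by blast+
    then show False using symR transR uv(3) by blast
  qed
  have fin: "finite (A // R)"
    using A R by (auto simp: equiv_def intro: finite_quotient)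
  have in_q: "?U \<in> A // R" "?W \<in> A // R" "?U \<noteq> ?W"
    using uv cls by (auto intro: quotientI)
  show ?thesis
    unfolding AS by (rule card_insert_Diff_doubleton[OF fin in_q notin])
qed

section \<open>The first Betti number\<close>

text \<open>The scalar multiplication is literally the one in \<open>betti1\<close>, so that
  \<open>chains.dim\<close> is the dimension used there.\<close>

interpretation chains: vector_space "\<lambda>(c::rat) (f :: 'e \<Rightarrow> rat) e. c * f e"
  by unfold_locales (auto simp: fun_eq_iff algebra_simps)

section \<open>Linearity of the boundary map and boundaries of paths\<close>

lemma chain_boundary_plus:
  "chain_boundary G (f + g) v = chain_boundary G f v + chain_boundary G g v"
  by (simp add: chain_boundary_def sum.distrib)

lemma chain_boundary_scale:
  "chain_boundary G (\<lambda>e. c * f e) v = c * chain_boundary G f v"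
  by (simp add: chain_boundary_def sum_distrib_left right_diff_distrib)

lemma chain_boundary_zero: "chain_boundary G (\<lambda>e. 0) v = 0"
  by (simp add: chain_boundary_def)

lemma subspace_cycle_space: "chains.subspace (cycle_space G)"
  by (rule chains.subspaceI)
     (auto simp: cycle_space_def chain_boundary_plus chain_boundary_scale
       chain_boundary_zero zero_fun_def)

lemma chain_boundary_single:
  assumes "finite (arcs G)" "e \<in> arcs G"
  shows "chain_boundary G (\<lambda>x. of_bool (x = e)) w = of_bool (head G e = w) - of_bool (tail G e = w)"
proof -
  have "finite (in_arcs G w)" "finite (out_arcs G w)"
    using assms(1) by (auto intro: rev_finite_subset simp: in_arcs_def out_arcs_def)
  then show ?thesis
    using assms(2) by (simp add: chain_boundary_def of_bool_def)
qed

text \<open>The signed sum of the edges of a path has boundary end minus start. No path is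
  constructed: the pairs of nodes whose difference is a boundary form an equivalence relation (zero,
  negative and sum of chains) that contains every arc.\<close>

lemma linked_imp_chain:
  fixes G :: "('v, 'e) pre_digraph"
  assumes wf: "wf_digraph G" and fin: "finite (arcs G)" and uv: "(u, v) \<in> linked G"
  shows "\<exists>f :: 'e \<Rightarrow> rat. (\<forall>e. e \<notin> arcs G \<longrightarrow> f e = 0) \<and>
    (\<forall>w. chain_boundary G f w = of_bool (v = w) - of_bool (u = w))"
proof -
  define P where "P u v f \<longleftrightarrow> (\<forall>e. e \<notin> arcs G \<longrightarrow> f e = 0) \<and>
    (\<forall>w. chain_boundary G f w = of_bool (v = w) - of_bool (u = w))" for u v and f :: "'e \<Rightarrow> rat"
  define R where "R = {(u, v). u \<in> verts G \<and> v \<in> verts G \<and> (\<exists>f. P u v f)}"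
  have refl: "P u u (\<lambda>e. 0)" for u
    by (simp add: P_def chain_boundary_zero)
  have sym: "\<exists>f. P v u f" if "P u v f" for u v f
    using that chain_boundary_scale[of G "-1" f]
    by (intro exI[of _ "\<lambda>e. - 1 * f e"]) (auto simp: P_def)
  have trans: "\<exists>f. P u w f" if "P u v f" "P v w g" for u v w f g
    using that by (intro exI[of _ "f + g"]) (auto simp: P_def chain_boundary_plus)
  have "linked G \<subseteq> R"
  proof (rule linked_least)
    show "equiv (verts G) R"
    proof (rule equivI)
      show "refl_on (verts G) R" using refl by (auto simp: R_def refl_on_def)
      show "sym R" using sym by (auto simp: R_def sym_def)
      show "trans R" using trans unfolding R_def trans_def by blast
    qed (auto simp: R_def)
  next
    fix e assume e: "e \<in> arcs G"
    then have "P (tail G e) (head G e) (\<lambda>x. of_bool (x = e))"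
      using chain_boundary_single[OF fin e] by (auto simp: P_def)
    with e wf show "(tail G e, head G e) \<in> R"
      by (auto simp: R_def wf_digraph.tail_in_verts wf_digraph.head_in_verts)
  qed
  with uv have "(u, v) \<in> R" by blast
  then show ?thesis by (simp add: R_def P_def)
qed

section \<open>Boundaries summed over a component\<close>

lemma sum_fibres:
  assumes "finite A" "finite K"
  shows "(\<Sum>w\<in>K. sum f {e \<in> A. h e = w}) = sum f {e \<in> A. h e \<in> K}"
proof -
  have "(\<Sum>w\<in>K. sum f {e \<in> A. h e = w}) = (\<Sum>w\<in>K. sum f {e \<in> {e \<in> A. h e \<in> K}. h e = w})"
    by (intro sum.cong refl) auto
  also have "\<dots> = sum f {e \<in> A. h e \<in> K}"
    by (rule sum.group) (use assms in auto)
  finally show ?thesis .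
qed

text \<open>An edge has both ends in \<open>K\<close> or neither, so its two contributions to the
  sum cancel.\<close>

lemma sum_chain_boundary_component:
  assumes wf: "wf_digraph G" and fin: "finite (arcs G)" "finite K"
    and K: "K \<in> conn_components G"
  shows "(\<Sum>w\<in>K. chain_boundary G f w) = 0"
proof -
  note eq = equiv_linked[OF wf]
  have Kq: "K \<in> verts G // linked G"
    using K by (simp add: conn_components_eq_quotient[OF wf])
  have "head G e \<in> K \<longleftrightarrow> tail G e \<in> K" if "e \<in> arcs G" for e
  proof -
    have "(tail G e, head G e) \<in> linked G" "(head G e, tail G e) \<in> linked G"
      using linked_arc[OF wf that] eq by (auto simp: equiv_def dest: symD)
    then show ?thesis
      using in_quotient_imp_closed[OF eq Kq] by blast
  qed
  then have "{e \<in> arcs G. head G e \<in> K} = {e \<in> arcs G. tail G e \<in> K}" by blast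
  then show ?thesis
    by (simp add: chain_boundary_def sum_subtractf in_arcs_def out_arcs_def sum_fibres[OF fin])
qed

text \<open>Euler's formula by induction on the edges. A new edge either joins nodes already linked,
  which adds one basis cycle and keeps the components, or joins two components into one and adds no
  cycle. Carrying an explicit basis turns the dimension into a cardinality.\<close>

lemma cycle_space_basis:
  fixes t h :: "'e \<Rightarrow> 'v"
  assumes "finite F" and V: "finite V" and "t ` F \<subseteq> V" "h ` F \<subseteq> V"
  shows "\<exists>B. finite B \<and> \<not> chains.dependent B
    \<and> chains.span B = cycle_space \<lparr>verts = V, arcs = F, tail = t, head = h\<rparr>
    \<and> card B + card V = card F + card (conn_components \<lparr>verts = V, arcs = F, tail = t, head = h\<rparr>)"
  using assms(1,3,4)
proof (induction F)
  case empty
  let ?G = "\<lparr>verts = V, arcs = {} :: 'e set, tail = t, head = h\<rparr>"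
  have wf: "wf_digraph ?G" by unfold_locales auto
  \<comment> \<open>Without edges every node is its own component and the only cycle is zero, so the
    empty basis satisfies the count.\<close>
  have "linked ?G \<subseteq> Id_on V"
    by (rule linked_least) (auto simp: equiv_def refl_on_def sym_def trans_def)
  then have "linked ?G = Id_on V"
    using equiv_linked[OF wf] by (auto simp: equiv_def refl_on_def)
  then have "conn_components ?G = (\<lambda>v. {v}) ` V"
    by (auto simp: conn_components_eq_quotient[OF wf] quotient_def)
  then have "card (conn_components ?G) = card V"
    by (simp add: card_image)
  moreover have "cycle_space ?G = {0}"
    by (auto simp: cycle_space_def chain_boundary_def in_arcs_def out_arcs_def zero_fun_def)
  ultimately show ?case
    using chains.independent_empty chains.span_empty
    by (intro exI[of _ "{}"]) (simp only: finite.emptyI card.empty add_0 not_False_eq_True)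
next
  case (insert e F)
  let ?G = "\<lparr>verts = V, arcs = F, tail = t, head = h\<rparr>"
  let ?G' = "\<lparr>verts = V, arcs = insert e F, tail = t, head = h\<rparr>"
  have ends: "t e \<in> V" "h e \<in> V" using insert.prems by auto
  have wf: "wf_digraph ?G" and wf': "wf_digraph ?G'"
    using insert.prems by (unfold_locales; auto)+
  have eqv: "equiv V (linked ?G)" and eqv': "equiv V (linked ?G')"
    using equiv_linked[OF wf] equiv_linked[OF wf'] by simp_all
  have mono: "linked ?G \<subseteq> linked ?G'"
    by (rule linked_least) (use eqv' linked_arc[OF wf'] in auto)
  have fin: "finite (in_arcs ?G w)" "finite (out_arcs ?G w)" for w
    using \<open>finite F\<close> by (auto simp: in_arcs_def out_arcs_def)
  have arcs': "in_arcs ?G' w = (if h e = w then insert e (in_arcs ?G w) else in_arcs ?G w)"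
    "out_arcs ?G' w = (if t e = w then insert e (out_arcs ?G w) else out_arcs ?G w)"
    "e \<notin> in_arcs ?G w" "e \<notin> out_arcs ?G w" for w
    using \<open>e \<notin> F\<close> by (auto simp: in_arcs_def out_arcs_def)
  have bd: "chain_boundary ?G' g w =
      chain_boundary ?G g w + g e * (of_bool (h e = w) - of_bool (t e = w))" for g w
    using sum.insert[OF fin(1) arcs'(3), of g w] sum.insert[OF fin(2) arcs'(4), of g w]
    by (simp add: chain_boundary_def arcs'(1,2))
  \<comment> \<open>The cycles of the smaller graph form the kernel of the coefficient at
    \<open>e\<close>, so the dimension grows by at most one.\<close>
  have cs: "cycle_space ?G = {g \<in> cycle_space ?G'. g e = 0}"
    using \<open>e \<notin> F\<close> by (auto simp: cycle_space_def bd)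
  have "t ` F \<subseteq> V" "h ` F \<subseteq> V" using insert.prems by auto
  from insert.IH[OF this] obtain B where B: "finite B" "\<not> chains.dependent B" "chains.span B = cycle_space ?G"
    "card B + card V = card F + card (conn_components ?G)"
    by (elim exE conjE)
  show ?case
  proof (cases "(t e, h e) \<in> linked ?G")
    case True
    have "linked ?G' \<subseteq> linked ?G"
      by (rule linked_least) (use eqv True linked_arc[OF wf] in auto)
    with mono have "linked ?G' = linked ?G" by blast
    then have comps: "conn_components ?G' = conn_components ?G"
      by (simp add: conn_components_eq_quotient[OF wf] conn_components_eq_quotient[OF wf'])
    have he: "(h e, t e) \<in> linked ?G" using eqv True by (auto simp: equiv_def dest: symD)
    have finG: "finite (arcs ?G)" using \<open>finite F\<close> by simp
    obtain f :: "'e \<Rightarrow> rat" where "\<forall>x. x \<notin> arcs ?G \<longrightarrow> f x = 0"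
      and bd_f: "\<forall>w. chain_boundary ?G f w = of_bool (t e = w) - of_bool (h e = w)"
      using linked_imp_chain[OF wf finG he] by (elim exE conjE)
    then have f: "f x = 0" if "x \<notin> F" for x using that by simp
    \<comment> \<open>\<open>f\<close> behaves like a path from \<open>h e\<close> back to
      \<open>t e\<close> in the old graph and vanishes at \<open>e\<close>; giving \<open>e\<close>
      the coefficient 1 closes it to a cycle.\<close>
    define z where "z = f(e := 1)"
    have "chain_boundary ?G z w = chain_boundary ?G f w" for w
      using arcs'(3,4)[of w] unfolding chain_boundary_def z_def
      by (intro arg_cong2[where f = "(-)"] sum.cong) auto
    then have z: "z \<in> cycle_space ?G'" "z e = 1"
      using f by (auto simp: cycle_space_def bd bd_f z_def)
    have z_span: "z \<notin> chains.span B" using z(2) by (simp add: B(3) cs)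
    have "chains.span (insert z B) = cycle_space ?G'"
    proof (intro set_eqI iffI)
      fix x assume "x \<in> chains.span (insert z B)"
      then obtain k where "x - (\<lambda>i. k * z i) \<in> cycle_space ?G'"
        unfolding chains.span_insert B(3) cs by auto
      from chains.subspace_add[OF subspace_cycle_space this
          chains.subspace_scale[OF subspace_cycle_space z(1), of k]]
      show "x \<in> cycle_space ?G'" by simp
    next
      fix x assume "x \<in> cycle_space ?G'"
      \<comment> \<open>Since \<open>z e = 1\<close>, subtracting the multiple \<open>x e\<close> of
        \<open>z\<close> removes \<open>e\<close> from \<open>x\<close> and leaves a cycle of the
        old graph.\<close>
      then have "x - (\<lambda>i. x e * z i) \<in> cycle_space ?G'"
        by (intro chains.subspace_diff chains.subspace_scale subspace_cycle_space z(1))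
      then show "x \<in> chains.span (insert z B)"
        unfolding chains.span_insert B(3) cs using z(2) by (intro CollectI exI[of _ "x e"]) simp
    qed
    moreover have "\<not> chains.dependent (insert z B)"
      using chains.independent_insertI[OF z_span B(2)] .
    moreover have "z \<notin> B" using z_span chains.span_base by blast
    ultimately show ?thesis
      using B \<open>finite F\<close> \<open>e \<notin> F\<close> by (intro exI[of _ "insert z B"]) (simp add: comps)
  next
    case False
    let ?K = "linked ?G `` {t e}"
    have K: "?K \<in> conn_components ?G"
      using ends by (auto simp: conn_components_eq_quotient[OF wf] intro: quotientI)
    have KV: "?K \<subseteq> V" using eqv by (auto simp: equiv_def)
    then have finK: "finite ?K" using V finite_subset by blast
    have te: "t e \<in> ?K" using eqv ends by (auto simp: equiv_def refl_on_def)
    \<comment> \<open>\<open>e\<close> is a bridge. Summed over the old component of its tail, the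
      boundary of a cycle is zero; all old edges cancel and only \<open>e\<close> leaves this
      component, contributing \<open>- g e\<close>.\<close>
    have "g e = 0" if g: "g \<in> cycle_space ?G'" for g
    proof -
      have "0 = (\<Sum>w\<in>?K. chain_boundary ?G' g w)"
        using g KV by (intro sum.neutral[symmetric]) (auto simp: cycle_space_def)
      also have "\<dots> = (\<Sum>w\<in>?K. g e * (of_bool (h e = w) - of_bool (t e = w)))"
        using sum_chain_boundary_component[OF wf _ finK K, of g] \<open>finite F\<close>
        by (simp add: bd sum.distrib)
      also have "\<dots> = g e * ((\<Sum>w\<in>?K. of_bool (h e = w)) - (\<Sum>w\<in>?K. of_bool (t e = w)))"
        by (simp add: sum_distrib_left[symmetric] sum_subtractf)
      also have "\<dots> = - g e"
        using finK te False by (simp add: of_bool_def)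
      finally show ?thesis by simp
    qed
    with cs have "cycle_space ?G' = cycle_space ?G" by auto
    moreover
    let ?S = "linked ?G \<union> linked ?G `` {t e} \<times> linked ?G `` {h e} \<union> linked ?G `` {h e} \<times> linked ?G `` {t e}"
    \<comment> \<open>The merged relation is an equivalence containing all arcs, which bounds
      \<open>linked ?G'\<close> from above; conversely, going through \<open>e\<close> links any two
      points of the two old classes.\<close>
    have "linked ?G' = ?S"
    proof
      have "(h e, h e) \<in> linked ?G" using eqv ends by (auto simp: equiv_def refl_on_def)
      then show "linked ?G' \<subseteq> ?S"
        using equiv_merge[OF eqv ends] te linked_arc[OF wf] by (intro linked_least) auto
      have th: "(t e, h e) \<in> linked ?G'" using linked_arc[OF wf', of e] by simp
      have "(x, y) \<in> linked ?G'" if "(t e, x) \<in> linked ?G" "(h e, y) \<in> linked ?G" for x y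
        using that[THEN subsetD[OF mono]] th eqv' unfolding equiv_def
        by (meson symD transD)
      moreover have "(y, x) \<in> linked ?G'" if "(t e, x) \<in> linked ?G" "(h e, y) \<in> linked ?G" for x y
        using calculation[OF that] eqv' unfolding equiv_def by (meson symD)
      ultimately show "?S \<subseteq> linked ?G'" using mono by auto
    qed
    then have "Suc (card (conn_components ?G')) = card (conn_components ?G)"
      using card_quotient_merge[OF V eqv ends False]
      by (simp add: conn_components_eq_quotient[OF wf] conn_components_eq_quotient[OF wf'])
    ultimately show ?thesis
      using B \<open>finite F\<close> \<open>e \<notin> F\<close> by (intro exI[of _ B]) simp
  qed
qed

lemma betti1_euler:
  fixes G :: "('v, 'e) pre_digraph"
  assumes "fin_digraph G"
  shows "betti1 G + card (verts G) = card (arcs G) + card (conn_components G)"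
proof -
  interpret fin_digraph G by fact
  have G: "G = \<lparr>verts = verts G, arcs = arcs G, tail = tail G, head = head G\<rparr>"
    by (cases G) simp
  have "tail G ` arcs G \<subseteq> verts G" "head G ` arcs G \<subseteq> verts G" by auto
  from cycle_space_basis[OF finite_arcs finite_verts this, folded G]
  obtain B where "\<not> chains.dependent B" "chains.span B = cycle_space G"
    "card B + card (verts G) = card (arcs G) + card (conn_components G)"
    by (elim exE conjE)
  then show ?thesis
    using chains.dim_span_eq_card_independent[of B] by (simp add: betti1_def)
qed

section \<open>Segments of a knot diagram\<close>

locale oriented_knot =
  fixes D :: knot_diagram
  assumes diagram: "oriented_knot_diagram D"
begin

definition crossing_points :: "complex set" where
  "crossing_points = (curve D \<circ> fst) ` double_params D"

lemma segments_eq_components: "segments D = components (range (curve D) - crossing_points)"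
  by (simp add: segments_def crossing_points_def)

lemma finite_double_params: "finite (double_params D)"
  using diagram by (simp add: oriented_knot_diagram_def)

lemma continuous_curve: "continuous_on S (curve D)"
  using diagram C1_differentiable_imp_continuous_on continuous_on_subset
  by (metis oriented_knot_diagram_def subset_UNIV)

section \<open>Periodicity and the parameters of crossing points\<close>

lemma curve_add_1: "curve D (t + 1) = curve D t"
  using diagram by (simp add: oriented_knot_diagram_def)

lemma curve_add_int: "curve D (t + of_int k) = curve D t"
proof (induction k rule: int_induct[where k = 0])
  case (step1 i)
  then show ?case using curve_add_1[of "t + of_int i"] by (simp add: add.assoc)
next
  case (step2 i)
  then show ?case using curve_add_1[of "t + of_int i - 1"] by (simp add: add_diff_eq)
qed simp

lemma curve_frac: "curve D (frac t) = curve D t"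
  using curve_add_int[of "frac t" "\<lfloor>t\<rfloor>"] by (simp add: frac_def)

text \<open>If the reduced parameter differs from the given preimage \<open>p\<close> of the same
  point, then it forms a double pair with \<open>p\<close>; either way it occurs in
  \<open>double_params D\<close>.\<close>

lemma frac_crossing_param:
  assumes "curve D u \<in> crossing_points"
  shows "frac u \<in> fst ` double_params D"
proof -
  obtain p q where pq: "(p, q) \<in> double_params D" "curve D u = curve D p"
    using assms by (auto simp: crossing_points_def)
  show ?thesis
  proof (cases "frac u = p")
    case False
    with pq have "(frac u, p) \<in> double_params D"
      by (auto simp: double_params_def curve_frac frac_lt_1)
    then show ?thesis by force
  qed (use pq in force)
qed

text \<open>Parameters of crossing points are integer translates of finitely many, so only finitely
  many lie within distance 1 of \<open>s\<close>. The parameter \<open>s\<close> is exempt because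
  it may itself run through a crossing.\<close>

lemma crossing_params_isolated:
  "\<exists>\<epsilon>>0. \<forall>u. u \<noteq> s \<longrightarrow> \<bar>u - s\<bar> < \<epsilon> \<longrightarrow> curve D u \<notin> crossing_points"
proof -
  define Z where "Z = {u. \<bar>u - s\<bar> < 1 \<and> curve D u \<in> crossing_points}"
  have "Z \<subseteq> (\<Union>k\<in>{\<lfloor>s - 1\<rfloor>..\<lfloor>s + 1\<rfloor>}. (\<lambda>p. p + of_int k) ` fst ` double_params D)"
  proof
    fix u assume u: "u \<in> Z"
    then have k: "\<lfloor>u\<rfloor> \<in> {\<lfloor>s - 1\<rfloor>..\<lfloor>s + 1\<rfloor>}"
      using floor_mono[of "s - 1" u] floor_mono[of u "s + 1"] by (auto simp: Z_def abs_less_iff)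
    have "frac u \<in> fst ` double_params D"
      using u by (simp add: Z_def frac_crossing_param)
    then have "u \<in> (\<lambda>p. p + of_int \<lfloor>u\<rfloor>) ` fst ` double_params D"
      by (rule image_eqI[rotated]) (simp add: frac_def)
    with k show "u \<in> (\<Union>k\<in>{\<lfloor>s - 1\<rfloor>..\<lfloor>s + 1\<rfloor>}. (\<lambda>p. p + of_int k) ` fst ` double_params D)"
      by (rule UN_I)
  qed
  then have "finite Z"
    by (rule finite_subset) (simp add: finite_double_params)
  then obtain \<delta> where \<delta>: "\<delta> > 0" "\<forall>x\<in>Z. x \<noteq> s \<longrightarrow> \<delta> \<le> dist s x"
    using finite_set_avoid[of Z s] by metis
  have "curve D u \<notin> crossing_points" if "u \<noteq> s" "\<bar>u - s\<bar> < min 1 \<delta>" for u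
    using \<delta>(2) that by (force simp: Z_def dist_real_def)
  with \<delta>(1) show ?thesis
    by (intro exI[of _ "min 1 \<delta>"]) simp
qed

text \<open>The unqualified \<open>connected\<close> is the predicate on digraphs here.\<close>

lemma segment_containing:
  assumes "topological_space_class.connected S" "S \<noteq> {}" "\<And>u. u \<in> S \<Longrightarrow> curve D u \<notin> crossing_points"
  shows "\<exists>A\<in>segments D. \<forall>u\<in>S. curve D u \<in> A"
proof -
  have "topological_space_class.connected (curve D ` S)"
    using assms(1) continuous_curve by (rule connected_continuous_image[rotated])
  moreover have "curve D ` S \<subseteq> range (curve D) - crossing_points" using assms(3) by auto
  moreover from this have "range (curve D) - crossing_points \<noteq> {}" using assms(2) by blast
  ultimately obtain A where "A \<in> components (range (curve D) - crossing_points)" "curve D ` S \<subseteq> A"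
    using exists_component_superset by metis
  then show ?thesis by (auto simp: segments_eq_components)
qed

lemma segments_disjoint:
  assumes "A \<in> segments D" "B \<in> segments D" "z \<in> A" "z \<in> B"
  shows "A = B"
  using assms components_nonoverlap unfolding segments_eq_components by blast

section \<open>One-sided germs of the curve and the segments they determine\<close>

lemma incoming_eqI:
  assumes "A \<in> segments D" "\<forall>\<^sub>F u in at_left s. curve D u \<in> A"
  shows "incoming D s = A"
  unfolding incoming_def
proof (rule the_equality)
  fix B assume B: "B \<in> segments D \<and> (\<forall>\<^sub>F u in at_left s. curve D u \<in> B)"
  with assms(2) have "\<forall>\<^sub>F u in at_left s. curve D u \<in> A \<and> curve D u \<in> B"
    by (simp add: eventually_conj_iff)
  then obtain u where "curve D u \<in> A \<and> curve D u \<in> B"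
    using eventually_happens'[OF trivial_limit_at_left_real] by blast
  with assms(1) B show "B = A" using segments_disjoint by blast
qed (use assms in simp)

lemma outgoing_eqI:
  assumes "A \<in> segments D" "\<forall>\<^sub>F u in at_right s. curve D u \<in> A"
  shows "outgoing D s = A"
  unfolding outgoing_def
proof (rule the_equality)
  fix B assume B: "B \<in> segments D \<and> (\<forall>\<^sub>F u in at_right s. curve D u \<in> B)"
  with assms(2) have "\<forall>\<^sub>F u in at_right s. curve D u \<in> A \<and> curve D u \<in> B"
    by (simp add: eventually_conj_iff)
  then obtain u where "curve D u \<in> A \<and> curve D u \<in> B"
    using eventually_happens'[OF trivial_limit_at_right_real] by blast
  with assms(1) B show "B = A" using segments_disjoint by blast
qed (use assms in simp)

text \<open>Near \<open>s\<close> the two open sides avoid all crossings and are connected, so each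
  stays in one segment. If \<open>s\<close> is not at a crossing, the full interval is connected as
  well and the two segments agree. One statement keeps a common radius for both sides.\<close>

lemma curve_germs:
  "incoming D s \<in> segments D \<and> outgoing D s \<in> segments D \<and>
   (curve D s \<notin> crossing_points \<longrightarrow> curve D s \<in> outgoing D s \<and> incoming D s = outgoing D s) \<and>
   (\<exists>\<epsilon>>0. (\<forall>u. s - \<epsilon> < u \<longrightarrow> u < s \<longrightarrow> curve D u \<in> incoming D s) \<and>
     (\<forall>u. s < u \<longrightarrow> u < s + \<epsilon> \<longrightarrow> curve D u \<in> outgoing D s))"
proof -
  obtain \<epsilon> where \<epsilon>0: "\<epsilon> > 0"
    and "\<forall>u. u \<noteq> s \<longrightarrow> \<bar>u - s\<bar> < \<epsilon> \<longrightarrow> curve D u \<notin> crossing_points"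
    using crossing_params_isolated[of s] by (elim exE conjE)
  then have \<epsilon>: "curve D u \<notin> crossing_points" if "u \<noteq> s" "\<bar>u - s\<bar> < \<epsilon>" for u
    using that by simp
  obtain L where L: "L \<in> segments D" "\<forall>u\<in>{s - \<epsilon><..<s}. curve D u \<in> L"
    using segment_containing[of "{s - \<epsilon><..<s}"] \<epsilon> \<epsilon>0 by auto
  obtain R where R: "R \<in> segments D" "\<forall>u\<in>{s<..<s + \<epsilon>}. curve D u \<in> R"
    using segment_containing[of "{s<..<s + \<epsilon>}"] \<epsilon> \<epsilon>0 by auto
  have "\<forall>\<^sub>F u in at_left s. curve D u \<in> L"
    by (rule eventually_at_leftI[of "s - \<epsilon>"]) (use L \<epsilon>0 in auto)
  then have inc: "incoming D s = L" using L(1) by (rule incoming_eqI[rotated])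
  have "\<forall>\<^sub>F u in at_right s. curve D u \<in> R"
    by (rule eventually_at_rightI[of _ "s + \<epsilon>"]) (use R \<epsilon>0 in auto)
  then have out: "outgoing D s = R" using R(1) by (rule outgoing_eqI[rotated])
  have "curve D s \<in> R \<and> L = R" if s: "curve D s \<notin> crossing_points"
  proof -
    have "curve D u \<notin> crossing_points" if "u \<in> {s - \<epsilon><..<s + \<epsilon>}" for u
      using s \<epsilon>[of u] that by (cases "u = s") (auto simp: abs_less_iff)
    then obtain A where A: "A \<in> segments D" "\<forall>u\<in>{s - \<epsilon><..<s + \<epsilon>}. curve D u \<in> A"
      using segment_containing[of "{s - \<epsilon><..<s + \<epsilon>}"] \<epsilon>0 by auto
    \<comment> \<open>The segment of the full interval meets that of each side at the midpoint of
      the side, and distinct segments are disjoint.\<close>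
    have "A = L"
      by (rule segments_disjoint[OF A(1) L(1) A(2)[rule_format] L(2)[rule_format], of "s - \<epsilon> / 2"])
         (use \<epsilon>0 in auto)
    moreover have "A = R"
      by (rule segments_disjoint[OF A(1) R(1) A(2)[rule_format] R(2)[rule_format], of "s + \<epsilon> / 2"])
         (use \<epsilon>0 in auto)
    ultimately show ?thesis using A(2) \<epsilon>0 by auto
  qed
  moreover have "\<exists>\<epsilon>>0. (\<forall>u. s - \<epsilon> < u \<longrightarrow> u < s \<longrightarrow> curve D u \<in> L) \<and>
     (\<forall>u. s < u \<longrightarrow> u < s + \<epsilon> \<longrightarrow> curve D u \<in> R)"
    using L(2) R(2) \<epsilon>0 by (intro exI[of _ \<epsilon>]) auto
  ultimately show ?thesis
    using L(1) R(1) by (simp add: inc out)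
qed

lemma incoming_in_segments: "incoming D s \<in> segments D"
  and outgoing_in_segments: "outgoing D s \<in> segments D"
  and incoming_eq_outgoing: "curve D s \<notin> crossing_points \<Longrightarrow> incoming D s = outgoing D s"
  and curve_in_outgoing: "curve D s \<notin> crossing_points \<Longrightarrow> curve D s \<in> outgoing D s"
  using curve_germs[of s] by simp_all

text \<open>As a function of the parameter, \<open>outgoing D\<close> is a right-continuous step
  function whose left limit at \<open>s\<close> is \<open>incoming D s\<close>.\<close>

lemma outgoing_locally:
  "\<exists>\<epsilon>>0. (\<forall>u. s - \<epsilon> < u \<longrightarrow> u < s \<longrightarrow> outgoing D u = incoming D s) \<and>
    (\<forall>u. s \<le> u \<longrightarrow> u < s + \<epsilon> \<longrightarrow> outgoing D u = outgoing D s)"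
proof -
  obtain \<epsilon> where \<epsilon>: "\<epsilon> > 0"
    "\<forall>u. s - \<epsilon> < u \<longrightarrow> u < s \<longrightarrow> curve D u \<in> incoming D s"
    "\<forall>u. s < u \<longrightarrow> u < s + \<epsilon> \<longrightarrow> curve D u \<in> outgoing D s"
    using curve_germs[of s] by (elim exE conjE)
  have "outgoing D u = incoming D s" if "s - \<epsilon> < u" "u < s" for u
    by (rule outgoing_eqI[OF incoming_in_segments], rule eventually_at_rightI[of _ s])
       (use \<epsilon>(2) that in auto)
  moreover have "outgoing D u = outgoing D s" if "s \<le> u" "u < s + \<epsilon>" for u
    by (rule outgoing_eqI[OF outgoing_in_segments], rule eventually_at_rightI[of _ "s + \<epsilon>"])
       (use \<epsilon>(3) that in auto)
  ultimately show ?thesis using \<epsilon>(1) by (intro exI[of _ \<epsilon>] conjI allI impI)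
qed

text \<open>A segment contains a non-crossing point of the curve, and at any parameter of that point
  it is the outgoing segment. Statements about plane sets thus become statements about parameters in
  one period.\<close>

lemma segments_eq_outgoing: "segments D = outgoing D ` {0..<1}"
proof
  show "segments D \<subseteq> outgoing D ` {0..<1}"
  proof
    fix A assume A: "A \<in> segments D"
    then have "A \<noteq> {}" "A \<subseteq> range (curve D) - crossing_points"
      by (simp_all add: segments_eq_components in_components_nonempty in_components_subset)
    then obtain t where "curve D t \<in> A" "curve D t \<notin> crossing_points"
      by blast
    then have t: "curve D (frac t) \<in> A" "curve D (frac t) \<notin> crossing_points"
      by (simp_all add: curve_frac)
    have "A = outgoing D (frac t)"
      by (rule segments_disjoint[OF A outgoing_in_segments t(1) curve_in_outgoing[OF t(2)]])
    then show "A \<in> outgoing D ` {0..<1}"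
      by (rule image_eqI) (simp add: frac_lt_1)
  qed
qed (auto intro: outgoing_in_segments)

text \<open>Around each parameter \<open>outgoing D\<close> takes at most two values, and finitely
  many such neighbourhoods cover the compact interval from 0 to 1.\<close>

lemma finite_segments: "finite (segments D)"
proof -
  have "\<exists>\<epsilon>>0. outgoing D ` ball s \<epsilon> \<subseteq> {incoming D s, outgoing D s}" for s
  proof -
    obtain \<epsilon> where \<epsilon>: "\<epsilon> > 0"
      "\<forall>u. s - \<epsilon> < u \<longrightarrow> u < s \<longrightarrow> outgoing D u = incoming D s"
      "\<forall>u. s \<le> u \<longrightarrow> u < s + \<epsilon> \<longrightarrow> outgoing D u = outgoing D s"
      using outgoing_locally[of s] by (elim exE conjE)
    have "outgoing D u \<in> {incoming D s, outgoing D s}" if "u \<in> ball s \<epsilon>" for u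
    proof -
      have "s - \<epsilon> < u \<and> u < s \<or> s \<le> u \<and> u < s + \<epsilon>" using that by (auto simp: dist_real_def)
      with \<epsilon>(2,3) show ?thesis by blast
    qed
    then have "outgoing D ` ball s \<epsilon> \<subseteq> {incoming D s, outgoing D s}" by (rule image_subsetI)
    with \<epsilon>(1) show ?thesis by (intro exI conjI)
  qed
  then obtain \<epsilon> where \<epsilon>: "\<And>s. \<epsilon> s > 0" "\<And>s. outgoing D ` ball s (\<epsilon> s) \<subseteq> {incoming D s, outgoing D s}"
    by metis
  obtain T where T: "T \<subseteq> {0..1}" "finite T" "{0..1} \<subseteq> (\<Union>s\<in>T. ball s (\<epsilon> s))"
    by (rule compactE_image[of "{0..1::real}" "{0..1}" "\<lambda>s. ball s (\<epsilon> s)"])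
       (use \<epsilon>(1) in \<open>auto intro: centre_in_ball[THEN iffD2]\<close>)
  have "segments D \<subseteq> (\<Union>s\<in>T. {incoming D s, outgoing D s})"
  proof
    fix A assume "A \<in> segments D"
    then obtain u where u: "u \<in> {0..1}" "A = outgoing D u" by (force simp: segments_eq_outgoing)
    with T(3) obtain s where "s \<in> T" "u \<in> ball s (\<epsilon> s)" by blast
    with u(2) \<epsilon>(2)[of s] show "A \<in> (\<Union>s\<in>T. {incoming D s, outgoing D s})" by blast
  qed
  then show ?thesis by (rule finite_subset) (use T(2) in auto)
qed

text \<open>The journey along the knot in the form of local constancy: the class of
  \<open>outgoing D\<close> under \<open>E\<close> changes neither between crossings nor, by
  \<open>crossing\<close>, at one, so it is constant on the connected interval of a period.\<close>

lemma segments_connected: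
  assumes E: "equiv (segments D) E"
    and crossing: "\<And>s t. (s, t) \<in> double_params D \<Longrightarrow> (incoming D s, outgoing D s) \<in> E"
    and AB: "A \<in> segments D" "B \<in> segments D"
  shows "(A, B) \<in> E"
proof -
  have refl: "(C, C) \<in> E" if "C \<in> segments D" for C
    using E that by (auto simp: equiv_def refl_on_def)
  have sym: "(C', C) \<in> E" if "(C, C') \<in> E" for C C'
    using E that by (auto simp: equiv_def dest: symD)
  have step: "(incoming D s, outgoing D s) \<in> E" if "s \<in> {0..<1}" for s
  proof (cases "curve D s \<in> crossing_points")
    case True
    moreover have "frac s = s" using that by (simp add: frac_eq)
    ultimately obtain t where "(s, t) \<in> double_params D"
      using frac_crossing_param[of s] by auto
    then show ?thesis by (rule crossing)
  next
    case False
    then show ?thesis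
      using incoming_eq_outgoing refl outgoing_in_segments by simp
  qed
  have "(outgoing D a, outgoing D b) \<in> E" if ab: "a \<in> {0..<1}" "b \<in> {0..<1}" for a b
  proof (rule connected_equivalence_relation[where S = "{0..<1::real}", OF _ ab])
    show "topological_space_class.connected {0..<1::real}" by simp
    show "(outgoing D y, outgoing D x) \<in> E" if "(outgoing D x, outgoing D y) \<in> E" for x y
      using that by (rule sym)
    show "(outgoing D x, outgoing D z) \<in> E"
      if "(outgoing D x, outgoing D y) \<in> E" "(outgoing D y, outgoing D z) \<in> E" for x y z
      using E that by (auto simp: equiv_def dest: transD)
    fix s :: real assume s: "s \<in> {0..<1}"
    obtain \<epsilon> where \<epsilon>: "\<epsilon> > 0"
      "\<forall>u. s - \<epsilon> < u \<longrightarrow> u < s \<longrightarrow> outgoing D u = incoming D s"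
      "\<forall>u. s \<le> u \<longrightarrow> u < s + \<epsilon> \<longrightarrow> outgoing D u = outgoing D s"
      using outgoing_locally[of s] by (elim exE conjE)
    show "\<exists>T. openin (top_of_set {0..<1}) T \<and> s \<in> T \<and> (\<forall>u\<in>T. (outgoing D s, outgoing D u) \<in> E)"
    proof (intro exI conjI ballI)
      show "openin (top_of_set {0..<1}) ({0..<1} \<inter> ball s \<epsilon>)" by (simp add: openin_open_Int)
      show "s \<in> {0..<1} \<inter> ball s \<epsilon>" using s \<epsilon>(1) by simp
      fix u assume "u \<in> {0..<1} \<inter> ball s \<epsilon>"
      then consider "s - \<epsilon> < u" "u < s" | "s \<le> u" "u < s + \<epsilon>"
        by (cases "u < s") (auto simp: dist_real_def)
      then show "(outgoing D s, outgoing D u) \<in> E"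
      proof cases
        case 1
        with \<epsilon>(2) have "outgoing D u = incoming D s" by blast
        then show ?thesis using sym[OF step[OF s]] by (simp only:)
      next
        case 2
        with \<epsilon>(3) have "outgoing D u = outgoing D s" by blast
        then show ?thesis using refl[OF outgoing_in_segments] by (simp only:)
      qed
    qed
  qed
  then show ?thesis using AB by (auto simp: segments_eq_outgoing)
qed

section \<open>Connectedness of the circle graph\<close>

lemma fin_digraph_oriented_resolution: "fin_digraph (oriented_resolution D)"
  by unfold_locales
     (auto simp: oriented_resolution_def incoming_in_segments outgoing_in_segments
       finite_segments finite_double_params)

lemma wf_oriented_resolution: "wf_digraph (oriented_resolution D)"
  using fin_digraph_oriented_resolution by (rule fin_digraph.axioms)

lemma verts_oriented_resolution: "verts (oriented_resolution D) = segments D"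
  by (simp add: oriented_resolution_def)

definition circle_through :: "complex set \<Rightarrow> complex set set" where
  "circle_through = component_of (oriented_resolution D)"

lemma circle_through_in_circles: "A \<in> segments D \<Longrightarrow> circle_through A \<in> circles D"
  unfolding circle_through_def circles_def
  by (rule component_of_in_conn_components[OF wf_oriented_resolution])
     (simp add: verts_oriented_resolution)

lemma circle_obtain:
  assumes "C \<in> circles D"
  obtains A where "A \<in> segments D" "C = circle_through A"
  using conn_component_obtain[OF wf_oriented_resolution, of C] assms
  by (auto simp: circles_def circle_through_def verts_oriented_resolution)

lemma circle_through_smoothing:
  assumes "(s, t) \<in> double_params D"
  shows "circle_through (incoming D s) = circle_through (outgoing D t)"
proof -
  have "(incoming D s, outgoing D t) \<in> linked (oriented_resolution D)"
    using linked_arc[OF wf_oriented_resolution, of "(s, t)"] assms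
    by (simp add: oriented_resolution_def)
  then show ?thesis
    unfolding circle_through_def
    by (simp add: component_of_eq_iff[OF wf_oriented_resolution] verts_oriented_resolution
        incoming_in_segments outgoing_in_segments)
qed

lemma finite_circles: "finite (circles D)"
  unfolding circles_def
  by (rule finite_conn_components[OF wf_oriented_resolution])
     (simp add: verts_oriented_resolution finite_segments)

lemma wf_seifert_minus: "wf_digraph (seifert_minus D)"
  and wf_seifert_plus: "wf_digraph (seifert_plus D)"
  by (unfold_locales;
      auto simp: seifert_minus_def seifert_plus_def seifert_graph_def
        circle_through_def[symmetric] circle_through_in_circles incoming_in_segments)+

lemma verts_seifert:
  "verts (seifert_graph D) = circles D"
  "verts (seifert_minus D) = circles D"
  "verts (seifert_plus D) = circles D"
  by (simp_all add: seifert_minus_def seifert_plus_def seifert_graph_def)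

lemma finite_conn_components_seifert:
  "finite (conn_components (seifert_minus D))"
  "finite (conn_components (seifert_plus D))"
  using finite_conn_components[OF wf_seifert_minus] finite_conn_components[OF wf_seifert_plus]
  by (simp_all add: verts_seifert finite_circles)

lemma fin_digraph_circle_graph: "fin_digraph (circle_graph D)"
  by unfold_locales
     (auto simp: circle_graph_def finite_circles finite_conn_components_seifert verts_seifert
       component_of_in_conn_components[OF wf_seifert_minus]
       component_of_in_conn_components[OF wf_seifert_plus])

lemma wf_circle_graph: "wf_digraph (circle_graph D)"
  using fin_digraph_circle_graph by (rule fin_digraph.axioms)

abbreviation node_minus where "node_minus C \<equiv> Inl (component_of (seifert_minus D) C)"
abbreviation node_plus where "node_plus C \<equiv> Inr (component_of (seifert_plus D) C)"

section \<open>Paths in the circle graph\<close>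

lemma circle_edge: "C \<in> circles D \<Longrightarrow> (node_minus C, node_plus C) \<in> linked (circle_graph D)"
  using linked_arc[OF wf_circle_graph, of C] by (simp add: circle_graph_def)

lemma linked_circle_graph_sym:
  "(x, y) \<in> linked (circle_graph D) \<Longrightarrow> (y, x) \<in> linked (circle_graph D)"
  using equiv_linked[OF wf_circle_graph] by (auto simp: equiv_def dest: symD)

lemma linked_circle_graph_trans:
  "(x, y) \<in> linked (circle_graph D) \<Longrightarrow> (y, z) \<in> linked (circle_graph D) \<Longrightarrow>
    (x, z) \<in> linked (circle_graph D)"
  using equiv_linked[OF wf_circle_graph] by (auto simp: equiv_def dest: transD)

lemma linked_circle_graph_refl:
  "x \<in> verts (circle_graph D) \<Longrightarrow> (x, x) \<in> linked (circle_graph D)"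
  using equiv_linked[OF wf_circle_graph] by (auto simp: equiv_def refl_on_def)

lemma node_minus_in_verts: "C \<in> circles D \<Longrightarrow> node_minus C \<in> verts (circle_graph D)"
  using component_of_in_conn_components[OF wf_seifert_minus]
  by (simp add: circle_graph_def verts_seifert)

text \<open>
  A crossing cannot be both positive and negative, so its edge survives in \<open>T\<^sup>-\<close> or in \<open>T\<^sup>+\<close>.
\<close>

lemma linked_seifert_arc:
  assumes "(s, t) \<in> crossings D"
  shows "(node_minus (circle_through (incoming D s)), node_minus (circle_through (incoming D t)))
    \<in> linked (circle_graph D)" (is "(node_minus ?C, node_minus ?C') \<in> _")
proof -
  have C: "?C \<in> circles D" "?C' \<in> circles D"
    by (simp_all add: circle_through_in_circles incoming_in_segments)
  have "\<not> (positive_crossing D (s, t) \<and> negative_crossing D (s, t))"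
    by (auto simp: positive_crossing_def negative_crossing_def)
  then consider "\<not> positive_crossing D (s, t)" | "\<not> negative_crossing D (s, t)"
    by blast
  then show ?thesis
  proof cases
    case 1
    then have "(s, t) \<in> arcs (seifert_minus D)"
      using assms by (simp add: seifert_minus_def seifert_graph_def)
    from linked_arc[OF wf_seifert_minus this]
    have "component_of (seifert_minus D) ?C = component_of (seifert_minus D) ?C'"
      by (subst component_of_eq_iff[OF wf_seifert_minus])
         (simp_all add: C verts_seifert, simp add: seifert_minus_def seifert_graph_def circle_through_def)
    then show ?thesis
      using linked_circle_graph_refl[OF node_minus_in_verts[OF C(1)]] by simp
  next
    case 2
    then have "(s, t) \<in> arcs (seifert_plus D)"
      using assms by (simp add: seifert_plus_def seifert_graph_def)
    from linked_arc[OF wf_seifert_plus this]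
    have "component_of (seifert_plus D) ?C = component_of (seifert_plus D) ?C'"
      by (subst component_of_eq_iff[OF wf_seifert_plus])
         (simp_all add: C verts_seifert, simp add: seifert_plus_def seifert_graph_def circle_through_def)
    \<comment> \<open>The two circles share their plus node, so the path runs along the edge
      \<open>?C\<close> to this node and back along the edge \<open>?C'\<close>.\<close>
    then have "(node_minus ?C, node_plus ?C') \<in> linked (circle_graph D)"
      using circle_edge[OF C(1)] by simp
    then show ?thesis
      using linked_circle_graph_sym[OF circle_edge[OF C(2)]] by (rule linked_circle_graph_trans)
  qed
qed

text \<open>Linkedness of minus nodes is pulled back to a relation \<open>E\<close> on segments
  through the circle of each segment, which reduces the claim to
  \<open>segments_connected\<close>.\<close>

lemma linked_node_minus:
  assumes "C \<in> circles D" "C' \<in> circles D"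
  shows "(node_minus C, node_minus C') \<in> linked (circle_graph D)"
proof -
  let ?f = "\<lambda>A. node_minus (circle_through A)"
  define E where "E = {(A, B). A \<in> segments D \<and> B \<in> segments D
    \<and> (?f A, ?f B) \<in> linked (circle_graph D)}"
  have E: "equiv (segments D) E"
  proof (rule equivI)
    show "refl_on (segments D) E"
      by (auto simp: E_def refl_on_def circle_through_in_circles
          intro!: linked_circle_graph_refl node_minus_in_verts)
    show "sym E" by (auto simp: E_def sym_def intro: linked_circle_graph_sym)
    show "trans E" by (auto simp: E_def trans_def intro: linked_circle_graph_trans)
  qed (auto simp: E_def)
  have crossing: "(incoming D s, outgoing D s) \<in> E" if st: "(s, t) \<in> double_params D" for s t
  proof -
    have ts: "(t, s) \<in> double_params D" using st by (auto simp: double_params_def)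
    have "over D s \<noteq> over D t"
      using diagram st by (auto simp: oriented_knot_diagram_def)
    with st ts have "(s, t) \<in> crossings D \<or> (t, s) \<in> crossings D"
      by (auto simp: crossings_def)
    then have "(?f (incoming D s), ?f (incoming D t)) \<in> linked (circle_graph D)"
      using linked_seifert_arc linked_circle_graph_sym by blast
    \<comment> \<open>Smoothing puts the segment leaving at \<open>s\<close> on the circle of the
      segment arriving at \<open>t\<close>, so the Seifert edge of the crossing relates the two
      segments of the strand through \<open>s\<close>.\<close>
    then show ?thesis
      using circle_through_smoothing[OF ts]
      by (simp add: E_def incoming_in_segments outgoing_in_segments)
  qed
  obtain A where A: "A \<in> segments D" "C = circle_through A"
    using assms(1) by (rule circle_obtain)
  obtain B where B: "B \<in> segments D" "C' = circle_through B"
    using assms(2) by (rule circle_obtain)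
  have "(A, B) \<in> E" using segments_connected[OF E crossing A(1) B(1)] .
  with A(2) B(2) show ?thesis by (simp add: E_def)
qed

text \<open>Every minus node is linked to that of \<open>C0\<close>, and every plus node is joined
  to a minus node by the edge of a circle in it. The circle \<open>C0\<close> exists even without
  crossings, so the count is one and not zero.\<close>

lemma card_conn_components_circle_graph: "card (conn_components (circle_graph D)) = 1"
proof -
  define C0 where "C0 = circle_through (outgoing D 0)"
  have C0: "C0 \<in> circles D"
    by (simp add: C0_def circle_through_in_circles outgoing_in_segments)
  have "(node_minus C0, x) \<in> linked (circle_graph D)" if "x \<in> verts (circle_graph D)" for x
  proof -
    from that consider K where "x = Inl K" "K \<in> conn_components (seifert_minus D)"
      | K where "x = Inr K" "K \<in> conn_components (seifert_plus D)"
      by (auto simp: circle_graph_def)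
    then show ?thesis
    proof cases
      case 1
      then obtain C where "C \<in> circles D" "x = node_minus C"
        using conn_component_obtain[OF wf_seifert_minus] verts_seifert(2) by metis
      with C0 show ?thesis using linked_node_minus by simp
    next
      case 2
      then obtain C where "C \<in> circles D" "x = node_plus C"
        using conn_component_obtain[OF wf_seifert_plus] verts_seifert(3) by metis
      with C0 show ?thesis
        using linked_circle_graph_trans[OF linked_node_minus circle_edge] by simp
    qed
  qed
  then have "conn_components (circle_graph D) \<subseteq> {linked (circle_graph D) `` {node_minus C0}}"
    using equiv_class_eq[OF equiv_linked[OF wf_circle_graph]]
    by (auto simp: conn_components_eq_quotient[OF wf_circle_graph] elim!: quotientE)
  moreover have "linked (circle_graph D) `` {node_minus C0} \<in> conn_components (circle_graph D)"
    unfolding conn_components_eq_quotient[OF wf_circle_graph]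
    by (rule quotientI[OF node_minus_in_verts[OF C0]])
  ultimately have "conn_components (circle_graph D) = {linked (circle_graph D) `` {node_minus C0}}"
    by blast
  then show ?thesis by simp
qed

text \<open>The single component supplies the summand 1 of \<open>Delta\<close>. The tags
  \<open>Inl\<close> and \<open>Inr\<close> keep the two kinds of nodes apart, so their numbers
  add.\<close>

lemma Delta_eq_betti1: "Delta D = int (betti1 (circle_graph D))"
proof -
  have "card (verts (circle_graph D)) =
      card (conn_components (seifert_minus D)) + card (conn_components (seifert_plus D))"
    using card_Plus[OF finite_conn_components_seifert] by (simp add: circle_graph_def Plus_def)
  moreover have "arcs (circle_graph D) = circles D" by (simp add: circle_graph_def)
  ultimately show ?thesis
    using betti1_euler[OF fin_digraph_circle_graph]
    by (simp add: Delta_def verts_seifert card_conn_components_circle_graph)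
qed

end

theorem proposition1p12:
  fixes D :: knot_diagram
  assumes "oriented_knot_diagram D"
  shows "(\<forall>C\<in>circles D. (\<exists>!K. K \<in> conn_components (seifert_minus D) \<and> C \<in> K) \<and>
                         (\<exists>!K. K \<in> conn_components (seifert_plus D) \<and> C \<in> K)) \<and>
         Delta D = int (betti1 (circle_graph D))"
proof -
  interpret oriented_knot D using assms by unfold_locales
  show ?thesis
    using ex1_conn_component[OF wf_seifert_minus] ex1_conn_component[OF wf_seifert_plus]
      Delta_eq_betti1 by (simp add: verts_seifert)
qed

end
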